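(* Let $n\ge 1$ and let $K\in\mathcal{M}_n(\mathbb{R})$. Then $K$ is a DPP kernel if and only if one of the following equivalent properties is satisfied (that is, "$K$ is a DPP kernel", (a), (b) and (c) are all equivalent): (a) for all $p\in\{0,1\}^n$, $\det\big(D(p)(I_n-K)+D(1_n-p)K\big)\geq 0$; (b) for all $p\in(0,1)^n$, $\det\big(D(p)(I_n-K)+D(1_n-p)K\big)> 0$; (c) for all non-zero $x\in\mathbb{R}^n$ there exists $i\in[n]$ such that $x_i(Kx)_i\geq 0$, $|(Kx)_i|\leq |x_i|$ and $x_i\neq 0$.
   Context: $[n]=\{1,\dots,n\}$; $\mathcal{M}_n(\mathbb{R})$ is the set of real $n\times n$ matrices; $I_n$ is the identity matrix; $1_n\in\mathbb{R}^n$ is the all-ones vector; $D(x)$ is the diagonal matrix with diagonal entries $x_1,\dots,x_n$. For $S\subset[n]$, $K_S$ is the principal submatrix of $K$ with rows and columns indexed by $S$, with $\det(K_\emptyset)=1$. The determinantal measure with kernel $K$ is the unique signed measure $\mu$ on the power set $\mathcal{P}([n])$ such that $\mu(\{X\in\mathcal{P}([n]): S\subset X\})=\det(K_S)$ for all $S\subset[n]$ (it has total mass $1$). $K$ is called a DPP kernel if this $\mu$ is a probability measure, i.e. $\mu(\{S\})\ge 0$ for all $S\subset[n]$. Kernels are not assumed symmetric. *)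

theory Defs
  imports
    Complex_Main
    "Jordan_Normal_Form.Determinant"
    "Jordan_Normal_Form.DL_Submatrix"
begin

(* Indices are 0-based throughout: [n] is rendered as {..<n}. *)

definition diag_vec :: "real vec \<Rightarrow> real mat" where
  "diag_vec x = mat_diag (dim_vec x) (\<lambda>i. x $ i)"

definition ones_vec :: "nat \<Rightarrow> real vec" where
  "ones_vec n = vec n (\<lambda>_. 1)"

(* As for emeasure, a signed measure is a total function that is 0 on non-members of the
   sigma-algebra M, so that it is determined by its values on M. *)
definition signed_measure :: "'a set set \<Rightarrow> ('a set \<Rightarrow> real) \<Rightarrow> bool" where
  "signed_measure M \<mu> \<longleftrightarrow>
     \<mu> {} = 0 \<and>
     (\<forall>A :: nat \<Rightarrow> 'a set. range A \<subseteq> M \<and> (\<Union>i. A i) \<in> M \<and>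
        (\<forall>i j. i \<noteq> j \<longrightarrow> A i \<inter> A j = {}) \<longrightarrow>
        (\<lambda>i. \<mu> (A i)) sums \<mu> (\<Union>i. A i)) \<and>
     (\<forall>A. A \<notin> M \<longrightarrow> \<mu> A = 0)"

definition is_determinantal_measure :: "nat \<Rightarrow> real mat \<Rightarrow> (nat set set \<Rightarrow> real) \<Rightarrow> bool" where
  "is_determinantal_measure n K \<mu> \<longleftrightarrow>
     signed_measure (Pow (Pow {..<n})) \<mu> \<and>
     (\<forall>S \<subseteq> {..<n}. \<mu> {X \<in> Pow {..<n}. S \<subseteq> X} = det (submatrix K S S))"

(* Well-defined by ex1_determinantal_measure below. *)
definition determinantal_measure :: "nat \<Rightarrow> real mat \<Rightarrow> nat set set \<Rightarrow> real" where
  "determinantal_measure n K = (THE \<mu>. is_determinantal_measure n K \<mu>)"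

definition dpp_kernel :: "nat \<Rightarrow> real mat \<Rightarrow> bool" where
  "dpp_kernel n K \<longleftrightarrow>
     K \<in> carrier_mat n n \<and> (\<forall>S \<subseteq> {..<n}. determinantal_measure n K {S} \<ge> 0)"

lemma signed_measure_disjoint_Un:
  assumes "signed_measure M \<mu>" "{} \<in> M" "A \<in> M" "B \<in> M" "A \<union> B \<in> M" "A \<inter> B = {}"
  shows "\<mu> (A \<union> B) = \<mu> A + \<mu> B"
proof -
  define F where "F = (\<lambda>i::nat. if i = 0 then A else if i = 1 then B else {})"
  have U: "(\<Union>i. F i) = A \<union> B"
    unfolding F_def by (auto split: if_splits)
  have "range F \<subseteq> M" "\<forall>i j. i \<noteq> j \<longrightarrow> F i \<inter> F j = {}"
    using assms by (auto simp: F_def)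
  with assms U have s: "(\<lambda>i. \<mu> (F i)) sums \<mu> (A \<union> B)"
    unfolding signed_measure_def by metis
  have "(\<lambda>i. \<mu> (F i)) sums (\<Sum>i\<in>{0,1}. \<mu> (F i))"
    using assms by (intro sums_finite) (auto simp: F_def signed_measure_def)
  with s show ?thesis by (auto simp: F_def dest: sums_unique2)
qed

lemma signed_measure_Pow_eq_sum:
  assumes "finite \<Omega>" "signed_measure (Pow \<Omega>) \<mu>" "A \<subseteq> \<Omega>"
  shows "\<mu> A = (\<Sum>x\<in>A. \<mu> {x})"
proof -
  have "finite A" using assms finite_subset by blast
  then show ?thesis using assms(3)
  proof (induction A rule: finite_induct)
    case empty
    then show ?case using assms by (simp add: signed_measure_def)
  next
    case (insert x A)
    have "\<mu> ({x} \<union> A) = \<mu> {x} + \<mu> A"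
      using insert assms by (intro signed_measure_disjoint_Un[of "Pow \<Omega>"]) auto
    then show ?case using insert by simp
  qed
qed

lemma signed_measure_point_masses:
  fixes w :: "'a \<Rightarrow> real"
  assumes "finite \<Omega>"
  shows "signed_measure (Pow \<Omega>) (\<lambda>A. if A \<subseteq> \<Omega> then \<Sum>x\<in>A. w x else 0)"
proof -
  have "(\<lambda>i. \<Sum>x\<in>A i. w x) sums (\<Sum>x\<in>(\<Union>i. A i). w x)"
    if sub: "\<And>i. A i \<subseteq> \<Omega>" and disj: "\<forall>i j. i \<noteq> j \<longrightarrow> A i \<inter> A j = {}" for A :: "nat \<Rightarrow> 'a set"
  proof -
    have fA: "finite (A i)" for i using sub assms finite_subset by blast
    define N where "N = {i. A i \<noteq> {}}"
    define c where "c = (\<lambda>i. SOME x. x \<in> A i)"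
    have c: "c i \<in> A i" if "i \<in> N" for i
      using that unfolding c_def N_def by (simp add: some_in_eq)
    have "inj_on c N" using c disj by (intro inj_onI) (metis IntI empty_iff)
    moreover have "c ` N \<subseteq> \<Omega>" using c sub by blast
    ultimately have fN: "finite N" using assms by (meson inj_on_finite)
    have "(\<Union>i. A i) = (\<Union>i\<in>N. A i)" by (auto simp: N_def)
    then have "(\<Sum>x\<in>(\<Union>i. A i). w x) = (\<Sum>i\<in>N. \<Sum>x\<in>A i. w x)"
      using fN fA disj by (simp add: sum.UNION_disjoint)
    moreover have "(\<lambda>i. \<Sum>x\<in>A i. w x) sums (\<Sum>i\<in>N. \<Sum>x\<in>A i. w x)"
      using fN by (intro sums_finite) (auto simp: N_def)
    ultimately show ?thesis by simp
  qed
  then show ?thesis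
    unfolding signed_measure_def by (auto simp: image_subset_iff)
qed

lemma superset_sum_inversion:
  fixes f :: "'a set \<Rightarrow> real"
  assumes "finite \<Omega>"
  obtains w where "\<And>S. S \<subseteq> \<Omega> \<Longrightarrow> (\<Sum>X \<in> {X \<in> Pow \<Omega>. S \<subseteq> X}. w X) = f S"
proof
  define F where "F = (\<lambda>U. f (\<Omega> - U))"
  define W where "W = (\<lambda>T. \<Sum>U \<in> Pow T. (- 1) ^ card U * F U)"
  fix S assume S: "S \<subseteq> \<Omega>"
  have "(\<Sum>X \<in> {X \<in> Pow \<Omega>. S \<subseteq> X}. (- 1) ^ card (\<Omega> - X) * W (\<Omega> - X))
      = (\<Sum>T \<in> Pow (\<Omega> - S). (- 1) ^ card T * W T)"
    using S by (intro sum.reindex_bij_witness[of _ "\<lambda>T. \<Omega> - T" "\<lambda>X. \<Omega> - X"]) auto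
  also have "\<dots> = F (\<Omega> - S)"
    using assms by (intro inclusion_exclusion_symmetric[symmetric]) (auto simp: W_def)
  also have "\<dots> = f S" using S by (simp add: F_def double_diff)
  finally show "(\<Sum>X \<in> {X \<in> Pow \<Omega>. S \<subseteq> X}. (- 1) ^ card (\<Omega> - X) * W (\<Omega> - X)) = f S" .
qed

lemma ex1_determinantal_measure: "\<exists>!\<mu>. is_determinantal_measure n K \<mu>"
proof (rule ex_ex1I)
  let ?P = "Pow {..<n}"
  obtain w where w: "\<And>S. S \<subseteq> {..<n} \<Longrightarrow>
      (\<Sum>X \<in> {X \<in> ?P. S \<subseteq> X}. w X) = det (submatrix K S S)"
    using superset_sum_inversion[of "{..<n}" "\<lambda>S. det (submatrix K S S)"] by blast
  show "\<exists>\<mu>. is_determinantal_measure n K \<mu>"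
    using signed_measure_point_masses[of ?P w] w
    by (intro exI[of _ "\<lambda>A. if A \<subseteq> ?P then \<Sum>x\<in>A. w x else 0"])
       (auto simp: is_determinantal_measure_def)
next
  let ?P = "Pow {..<n}"
  fix \<mu> \<nu> assume m: "is_determinantal_measure n K \<mu>" and v: "is_determinantal_measure n K \<nu>"
  have sm: "signed_measure (Pow ?P) \<mu>" "signed_measure (Pow ?P) \<nu>"
    using m v by (auto simp: is_determinantal_measure_def)
  have pt: "\<mu> {S} = \<nu> {S}" if "S \<subseteq> {..<n}" for S
    using that
  proof (induction "card ({..<n} - S)" arbitrary: S rule: less_induct)
    case less
    let ?U = "{X \<in> ?P. S \<subseteq> X}"
    have fU: "finite ?U" by simp
    have "\<mu> {X} = \<nu> {X}" if "X \<in> ?U - {S}" for X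
    proof (rule less.hyps)
      show "card ({..<n} - X) < card ({..<n} - S)"
        using that less.prems by (intro psubset_card_mono) auto
    qed (use that in auto)
    then have eq: "(\<Sum>X\<in>?U - {S}. \<mu> {X}) = (\<Sum>X\<in>?U - {S}. \<nu> {X})"
      by (rule sum.cong[OF refl])
    have "\<mu> ?U = \<nu> ?U" using m v less.prems by (simp add: is_determinantal_measure_def)
    then have "(\<Sum>X\<in>?U. \<mu> {X}) = (\<Sum>X\<in>?U. \<nu> {X})"
      using signed_measure_Pow_eq_sum[OF _ sm(1), of ?U]
            signed_measure_Pow_eq_sum[OF _ sm(2), of ?U] by force
    moreover have "S \<in> ?U" using less.prems by simp
    ultimately show ?case
      using eq sum.remove[OF fU, of S "\<lambda>X. \<mu> {X}"] sum.remove[OF fU, of S "\<lambda>X. \<nu> {X}"]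
      by linarith
  qed
  show "\<mu> = \<nu>"
  proof
    fix A show "\<mu> A = \<nu> A"
    proof (cases "A \<subseteq> ?P")
      case True
      then show ?thesis
        using pt signed_measure_Pow_eq_sum[OF _ sm(1), of A]
              signed_measure_Pow_eq_sum[OF _ sm(2), of A]
        by (auto intro!: sum.cong)
    next
      case False
      then show ?thesis using sm by (auto simp: signed_measure_def)
    qed
  qed
qed

lemma is_determinantal_measure_determinantal_measure:
  "is_determinantal_measure n K (determinantal_measure n K)"
  unfolding determinantal_measure_def by (rule theI'[OF ex1_determinantal_measure])

end

theory Submission
  imports Defs
begin

text \<open>
  Write $M(p) = D(p)(I - K) + D(1 - p)K$, and for a set $S$ of indices let $w(S)$ be the determinant
  of the matrix whose rows are those of $K$ on $S$ and those of $I - K$ off $S$. Everything rests on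
  the fact that the determinant is linear in each row separately.

  The weights $w$ are the point masses of the determinantal measure. Summing $w(X)$ over all
  $X \<supseteq> S$ adds, for each $i \<notin> S$, the two possible choices of the row $i$; they add up to the row
  of the identity, and a matrix with identity rows off $S$ has determinant $\det(K_S)$. Since these
  sums determine the measure, $\mu(\{S\}) = w(S)$, and $K$ is a DPP kernel iff $w \<ge> 0$. This is
  property (a), because $w(S) = \det M(p)$ for the vertex $p$ of the cube that is $0$ on $S$ and $1$
  off $S$.

  By multilinearity again, $\det M(p) = \sum_X \prod_{i \in X}(1 - p_i) \prod_{i \notin X} p_i \, w(X)$.
  On the open cube all coefficients are positive, and $\sum_X w(X) = 1$ forces some $w(X)$ to be
  non-zero, so $w \<ge> 0$ gives (b). Conversely each vertex is a limit of points of the open cube, so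
  (b) gives $w \<ge> 0$.

  Finally, (c) says exactly that $M(p)$ is nonsingular for all $p$ in the open cube: with $y = Kx$,
  the equation $M(p)x = 0$ reads $p_i(x_i - y_i) + (1 - p_i)y_i = 0$ for all $i$. When $x_i \<noteq> 0$ this has
  a solution $p_i \in (0,1)$ iff $y_i / x_i \<notin> [0,1]$, and when $x_i = 0$ it is solved by
  $p_i = 1/2$. Nonsingularity on the open cube is the same as positivity there, by the intermediate
  value theorem along the segment to the centre, where $M(p) = I/2$.
\<close>

section \<open>Expanding determinants by choices of rows\<close>

definition choose_rows :: "'a mat \<Rightarrow> 'a mat \<Rightarrow> nat set \<Rightarrow> 'a mat" where
  "choose_rows A B X =
     mat (dim_row A) (dim_col A) (\<lambda>(i, j). if i \<in> X then A $$ (i, j) else B $$ (i, j))"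

lemma choose_rows_carrier [simp]:
  "A \<in> carrier_mat n m \<Longrightarrow> choose_rows A B X \<in> carrier_mat n m"
  by (simp add: choose_rows_def)

text \<open>Multilinearity in the rows, in the form used for all expansions below. In the permutation
  expansion of the determinant, each product over the rows is multiplied out into a sum over the set
  \<^term>\<open>X\<close> of rows that contribute their first summand.\<close>

lemma det_combine_rows:
  fixes A B :: "'a :: comm_ring_1 mat"
  assumes A: "A \<in> carrier_mat n n"
  shows "det (mat n n (\<lambda>(i, j). a i * A $$ (i, j) + b i * B $$ (i, j))) =
    (\<Sum>X \<in> Pow {..<n}. (\<Prod>i\<in>X. a i) * (\<Prod>i\<in>{..<n} - X. b i) * det (choose_rows A B X))"
proof -
  let ?P = "{p. p permutes {0..<n}}"
  let ?C = "\<lambda>X. (\<Prod>i\<in>X. a i) * (\<Prod>i\<in>{..<n} - X. b i)"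
  let ?R = "\<lambda>X p. \<Prod>i<n. choose_rows A B X $$ (i, p i)"
  have entry: "(\<Prod>i\<in>X. a i * A $$ (i, p i)) * (\<Prod>i\<in>{..<n} - X. b i * B $$ (i, p i)) = ?C X * ?R X p"
    if p: "p permutes {0..<n}" and X: "X \<subseteq> {..<n}" for p X
  proof -
    have pn: "p i < n" if "i < n" for i using p that permutes_in_image[OF p, of i] by auto
    have "?R X p = (\<Prod>i\<in>X. choose_rows A B X $$ (i, p i)) *
                   (\<Prod>i\<in>{..<n} - X. choose_rows A B X $$ (i, p i))"
      using X by (subst prod.subset_diff[OF X]) (auto simp: mult.commute)
    also have "(\<Prod>i\<in>X. choose_rows A B X $$ (i, p i)) = (\<Prod>i\<in>X. A $$ (i, p i))"
      using A X pn by (intro prod.cong) (auto simp: choose_rows_def)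
    also have "(\<Prod>i\<in>{..<n} - X. choose_rows A B X $$ (i, p i)) = (\<Prod>i\<in>{..<n} - X. B $$ (i, p i))"
      using A X pn by (intro prod.cong) (auto simp: choose_rows_def)
    finally show ?thesis by (simp add: prod.distrib mult_ac)
  qed
  have "det (mat n n (\<lambda>(i, j). a i * A $$ (i, j) + b i * B $$ (i, j))) =
      (\<Sum>p\<in>?P. of_int (sign p) * (\<Prod>i<n. a i * A $$ (i, p i) + b i * B $$ (i, p i)))"
  proof (subst det_def'[of _ n], simp, intro sum.cong refl arg_cong2[where f = "(*)"])
    fix p assume "p \<in> ?P"
    then have "p i < n" if "i < n" for i using that permutes_in_image[of p "{0..<n}" i] by auto
    then show "(\<Prod>i = 0..<n. mat n n (\<lambda>(i, j). a i * A $$ (i, j) + b i * B $$ (i, j)) $$ (i, p i)) =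
        (\<Prod>i<n. a i * A $$ (i, p i) + b i * B $$ (i, p i))"
      by (intro prod.cong) auto
  qed
  also have "\<dots> = (\<Sum>p\<in>?P. \<Sum>X\<in>Pow {..<n}. of_int (sign p) * (?C X * ?R X p))"
    by (intro sum.cong refl) (simp add: prod_add sum_distrib_left entry)
  also have "\<dots> = (\<Sum>X\<in>Pow {..<n}. ?C X * (\<Sum>p\<in>?P. of_int (sign p) * ?R X p))"
    by (subst sum.swap) (simp add: sum_distrib_left mult_ac)
  also have "\<dots> = (\<Sum>X\<in>Pow {..<n}. ?C X * det (choose_rows A B X))"
    using A by (intro sum.cong refl)
      (subst det_def'[of _ n], auto simp: lessThan_atLeast0)
  finally show ?thesis .
qed

section \<open>Principal minors\<close>

lemma bij_betw_pick:
  assumes "finite S"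
  shows "bij_betw (pick S) {0..<card S} S"
proof (rule bij_betw_imageI)
  show "inj_on (pick S) {0..<card S}"
  proof (rule inj_onI)
    fix i j assume ij: "i \<in> {0..<card S}" "j \<in> {0..<card S}" and eq: "pick S i = pick S j"
    have "card {a \<in> S. a < pick S i} = i" "card {a \<in> S. a < pick S j} = j"
      using ij by (auto intro!: card_pick)
    then show "i = j" unfolding eq by (rule trans[OF sym])
  qed
  then have "card (pick S ` {0..<card S}) = card S" by (subst card_image) auto
  moreover have "pick S ` {0..<card S} \<subseteq> S" by (auto intro: pick_in_set)
  ultimately show "pick S ` {0..<card S} = S" using card_subset_eq[OF assms] by blast
qed

text \<open>A row of the identity at position \<^term>\<open>i\<close> eliminates all permutations that move
  \<^term>\<open>i\<close>, so only the permutations of \<^term>\<open>S\<close> contribute. Relabelling \<^term>\<open>S\<close> by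
  \<^term>\<open>pick S\<close>, which leaves signs unchanged, turns them into the permutations that index the
  expansion of the minor.\<close>

lemma det_choose_rows_one:
  fixes A :: "'a :: comm_ring_1 mat"
  assumes A: "A \<in> carrier_mat n n" and S: "S \<subseteq> {..<n}"
  shows "det (choose_rows A (1\<^sub>m n) S) = det (submatrix A S S)"
proof -
  let ?k = "card S" and ?B = "choose_rows A (1\<^sub>m n) S"
  have fin: "finite S" using S finite_subset by blast
  have bij: "bij_betw (pick S) {0..<?k} S" using bij_betw_pick[OF fin] .
  have rows: "{i. i < n \<and> i \<in> S} = S" using S by auto
  have sub: "submatrix A S S \<in> carrier_mat ?k ?k"
    using A dim_submatrix[of A S S] rows by (intro carrier_matI) auto
  have "det ?B = (\<Sum>p | p permutes {0..<n}. of_int (sign p) * (\<Prod>i = 0..<n. ?B $$ (i, p i)))"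
    using A by (intro det_def') simp
  also have "\<dots> = (\<Sum>p | p permutes S. of_int (sign p) * (\<Prod>i = 0..<n. ?B $$ (i, p i)))"
  proof (rule sum.mono_neutral_right)
    show "finite {p. p permutes {0..<n}}" by (simp add: finite_permutations)
    show "{p. p permutes S} \<subseteq> {p. p permutes {0..<n}}"
      using S permutes_subset[of _ S "{0..<n}"] by (auto simp: lessThan_atLeast0)
    show "\<forall>p\<in>{p. p permutes {0..<n}} - {p. p permutes S}.
        of_int (sign p) * (\<Prod>i = 0..<n. ?B $$ (i, p i)) = 0"
    proof
      fix p assume p: "p \<in> {p. p permutes {0..<n}} - {p. p permutes S}"
      then obtain i where i: "i < n" "i \<notin> S" "p i \<noteq> i"
        using permutes_superset[of p "{0..<n}" S] by auto
      moreover have "p i < n" using p i permutes_in_image[of p "{0..<n}" i] by auto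
      ultimately have "?B $$ (i, p i) = 0" using A by (simp add: choose_rows_def)
      then have "(\<Prod>i = 0..<n. ?B $$ (i, p i)) = 0" using i by (intro prod_zero) auto
      then show "of_int (sign p) * (\<Prod>i = 0..<n. ?B $$ (i, p i)) = 0" by simp
    qed
  qed
  also have "\<dots> = (\<Sum>p | p permutes S. of_int (sign p) * (\<Prod>i\<in>S. A $$ (i, p i)))"
  proof (intro sum.cong refl arg_cong2[where f = "(*)"])
    fix p assume p: "p \<in> {p. p permutes S}"
    have "(\<Prod>i = 0..<n. ?B $$ (i, p i)) = (\<Prod>i\<in>S. ?B $$ (i, p i))"
      using S p A by (intro prod.mono_neutral_right) (auto simp: choose_rows_def permutes_not_in)
    also have "\<dots> = (\<Prod>i\<in>S. A $$ (i, p i))"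
    proof (rule prod.cong[OF refl])
      fix i assume "i \<in> S"
      then have "i < n" "p i < n" using S p permutes_in_image[of p S i] by auto
      then show "?B $$ (i, p i) = A $$ (i, p i)"
        using A \<open>i \<in> S\<close> by (simp add: choose_rows_def)
    qed
    finally show "(\<Prod>i = 0..<n. ?B $$ (i, p i)) = (\<Prod>i\<in>S. A $$ (i, p i))" .
  qed
  also have "\<dots> = (\<Sum>q | q permutes {0..<?k}.
      of_int (sign q) * (\<Prod>i = 0..<?k. submatrix A S S $$ (i, q i)))"
  proof (rule sum.reindex_bij_witness[of _ "map_permutation {0..<?k} (pick S)"
        "map_permutation S (inv_into {0..<?k} (pick S))"])
    fix p assume p: "p \<in> {p. p permutes S}"
    let ?q = "map_permutation S (inv_into {0..<?k} (pick S)) p"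
    have bij': "bij_betw (inv_into {0..<?k} (pick S)) S {0..<?k}"
      using bij by (rule bij_betw_inv_into)
    show "map_permutation {0..<?k} (pick S) ?q = p"
      using p by (intro map_permutation_compose_inv[OF bij'])
        (auto intro: bij_betw_inv_into_right[OF bij])
    show q: "?q \<in> {q. q permutes {0..<?k}}"
      using p map_permutation_permutes[OF bij'] by auto
    have sgn: "sign ?q = sign p"
      using p bij' fin by (intro sign_map_permutation) (auto simp: bij_betw_def)
    have "(\<Prod>i = 0..<?k. submatrix A S S $$ (i, ?q i)) = (\<Prod>i = 0..<?k. A $$ (pick S i, p (pick S i)))"
    proof (rule prod.cong[OF refl])
      fix i assume i: "i \<in> {0..<?k}"
      have qi: "?q i < ?k" using i q permutes_in_image[of ?q "{0..<?k}" i] by auto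
      have "pick S i \<in> S" using i by (auto intro: pick_in_set)
      then have "p (pick S i) \<in> S" using p permutes_in_image[of p S] by auto
      have "?q (inv_into {0..<?k} (pick S) (pick S i)) = inv_into {0..<?k} (pick S) (p (pick S i))"
        using bij' \<open>pick S i \<in> S\<close> by (intro map_permutation_apply) (auto simp: bij_betw_def)
      then have "pick S (?q i) = p (pick S i)"
        using bij_betw_inv_into_left[OF bij i] bij_betw_inv_into_right[OF bij \<open>p (pick S i) \<in> S\<close>]
        by simp
      then show "submatrix A S S $$ (i, ?q i) = A $$ (pick S i, p (pick S i))"
        using A i qi rows by (subst submatrix_index) auto
    qed
    also have "\<dots> = (\<Prod>i\<in>S. A $$ (i, p i))"
      using prod.reindex_bij_betw[OF bij, of "\<lambda>i. A $$ (i, p i)"] .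
    finally show "of_int (sign ?q) * (\<Prod>i = 0..<?k. submatrix A S S $$ (i, ?q i)) =
        of_int (sign p) * (\<Prod>i\<in>S. A $$ (i, p i))" by (simp add: sgn)
  next
    fix q assume q: "q \<in> {q. q permutes {0..<?k}}"
    show "map_permutation S (inv_into {0..<?k} (pick S)) (map_permutation {0..<?k} (pick S) q) = q"
      using q by (intro map_permutation_compose_inv[OF bij])
        (auto intro: bij_betw_inv_into_left[OF bij])
    show "map_permutation {0..<?k} (pick S) q \<in> {p. p permutes S}"
      using q map_permutation_permutes[OF bij] by auto
  qed
  also have "\<dots> = det (submatrix A S S)"
    by (rule det_def'[OF sub, symmetric])
  finally show ?thesis .
qed

section \<open>The point masses of the determinantal measure\<close>

text \<open>The rows of \<^term>\<open>choose_rows K (1\<^sub>m n) S\<close> are \<^term>\<open>K\<close> plus \<^term>\<open>b i\<close> times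
  \<^term>\<open>1\<^sub>m n - K\<close>, with \<^term>\<open>b i\<close> equal to \<^term>\<open>0\<close> on \<^term>\<open>S\<close> and to \<^term>\<open>1\<close>
  elsewhere. In the expansion, the factor zero removes exactly the sets \<^term>\<open>X\<close> that do not
  contain \<^term>\<open>S\<close>.\<close>

lemma sum_supersets_det_choose_rows:
  fixes K :: "'a :: comm_ring_1 mat"
  assumes K: "K \<in> carrier_mat n n" and S: "S \<subseteq> {..<n}"
  shows "(\<Sum>X \<in> {X \<in> Pow {..<n}. S \<subseteq> X}. det (choose_rows K (1\<^sub>m n - K) X)) = det (submatrix K S S)"
proof -
  let ?w = "\<lambda>X. det (choose_rows K (1\<^sub>m n - K) X)"
  let ?b = "\<lambda>i. if i \<in> S then 0 else 1 :: 'a"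
  have "choose_rows K (1\<^sub>m n) S =
      mat n n (\<lambda>(i, j). 1 * K $$ (i, j) + ?b i * (1\<^sub>m n - K) $$ (i, j))"
    using K by (intro eq_matI) (auto simp: choose_rows_def)
  then have "det (submatrix K S S) = (\<Sum>X \<in> Pow {..<n}. (\<Prod>i\<in>{..<n} - X. ?b i) * ?w X)"
    using det_choose_rows_one[OF K S] det_combine_rows[OF K, of "\<lambda>_. 1" ?b "1\<^sub>m n - K"] by simp
  also have "\<dots> = (\<Sum>X \<in> Pow {..<n}. if S \<subseteq> X then ?w X else 0)"
  proof (rule sum.cong[OF refl])
    fix X assume "X \<in> Pow {..<n}"
    show "(\<Prod>i\<in>{..<n} - X. ?b i) * ?w X = (if S \<subseteq> X then ?w X else 0)"
    proof (cases "S \<subseteq> X")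
      case True
      then have "(\<Prod>i\<in>{..<n} - X. ?b i) = 1" by (intro prod.neutral) auto
      with True show ?thesis by simp
    next
      case False
      then have "(\<Prod>i\<in>{..<n} - X. ?b i) = 0" using S by (intro prod_zero) auto
      with False show ?thesis by simp
    qed
  qed
  also have "\<dots> = (\<Sum>X \<in> {X \<in> Pow {..<n}. S \<subseteq> X}. ?w X)"
    by (subst sum.inter_filter[symmetric]) auto
  finally show ?thesis by simp
qed

text \<open>The total mass of the determinantal measure is \<^term>\<open>1\<close>, so its point masses cannot all
  vanish; this is what makes the inequality on the open cube strict.\<close>

lemma sum_det_choose_rows:
  fixes K :: "'a :: comm_ring_1 mat"
  assumes "K \<in> carrier_mat n n"
  shows "(\<Sum>X \<in> Pow {..<n}. det (choose_rows K (1\<^sub>m n - K) X)) = 1"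
proof -
  have "{X \<in> Pow {..<n}. {} \<subseteq> X} = Pow {..<n}" by auto
  moreover have "submatrix K {} {} \<in> carrier_mat 0 0"
    by (intro carrier_matI) (simp_all add: dim_submatrix)
  ultimately show ?thesis
    using sum_supersets_det_choose_rows[OF assms, of "{}"] det_dim_zero[of "submatrix K {} {}"] by simp
qed

text \<open>The determinants of the row choices, taken as point masses, define a signed measure with the
  prescribed inclusion values, and there is only one such measure.\<close>

lemma determinantal_measure_singleton:
  assumes K: "K \<in> carrier_mat n n" and S: "S \<subseteq> {..<n}"
  shows "determinantal_measure n K {S} = det (choose_rows K (1\<^sub>m n - K) S)"
proof -
  let ?P = "Pow {..<n}" and ?w = "\<lambda>X. det (choose_rows K (1\<^sub>m n - K) X)"
  let ?\<mu> = "\<lambda>A. if A \<subseteq> ?P then \<Sum>X\<in>A. ?w X else 0"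
  have "is_determinantal_measure n K ?\<mu>"
    unfolding is_determinantal_measure_def
  proof (intro conjI allI impI)
    show "signed_measure (Pow ?P) ?\<mu>" by (rule signed_measure_point_masses) simp
    fix T assume "T \<subseteq> {..<n}"
    then show "?\<mu> {X \<in> ?P. T \<subseteq> X} = det (submatrix K T T)"
      using sum_supersets_det_choose_rows[OF K] by auto
  qed
  then have "determinantal_measure n K = ?\<mu>"
    unfolding determinantal_measure_def by (rule the1_equality[OF ex1_determinantal_measure])
  then have "determinantal_measure n K {S} = ?\<mu> {S}" by (rule fun_cong)
  also have "\<dots> = ?w S" using S by simp
  finally show ?thesis .
qed

lemma dpp_kernel_iff_det_choose_rows:
  assumes "K \<in> carrier_mat n n"
  shows "dpp_kernel n K \<longleftrightarrow> (\<forall>S \<subseteq> {..<n}. det (choose_rows K (1\<^sub>m n - K) S) \<ge> 0)"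
  unfolding dpp_kernel_def using assms determinantal_measure_singleton[OF assms] by metis

section \<open>The interpolation between a kernel and its complement\<close>

text \<open>This is the matrix $D(p)(I_n - K) + D(1_n - p)K$, written entrywise and with
  \<^term>\<open>p\<close> as a function, so that its determinant is an instance of
  \<open>det_combine_rows\<close>.\<close>

definition interp_mat :: "nat \<Rightarrow> real mat \<Rightarrow> (nat \<Rightarrow> real) \<Rightarrow> real mat" where
  "interp_mat n K p = mat n n (\<lambda>(i, j). (1 - p i) * K $$ (i, j) + p i * (1\<^sub>m n - K) $$ (i, j))"

lemma interp_mat_carrier [simp]: "interp_mat n K p \<in> carrier_mat n n"
  by (simp add: interp_mat_def)

lemma interp_mat_eq:
  assumes K: "K \<in> carrier_mat n n" and p: "p \<in> carrier_vec n"
  shows "diag_vec p * (1\<^sub>m n - K) + diag_vec (ones_vec n - p) * K = interp_mat n K (($) p)"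
proof -
  have 1: "diag_vec p * (1\<^sub>m n - K) = mat n n (\<lambda>(i, j). p $ i * (1\<^sub>m n - K) $$ (i, j))"
    unfolding diag_vec_def carrier_vecD[OF p] by (rule mat_diag_mult_left) (use K in auto)
  have 2: "diag_vec (ones_vec n - p) * K = mat n n (\<lambda>(i, j). (ones_vec n - p) $ i * K $$ (i, j))"
    unfolding diag_vec_def index_minus_vec carrier_vecD[OF p] by (rule mat_diag_mult_left[OF K])
  show ?thesis
    unfolding 1 2 interp_mat_def using K p by (intro eq_matI) (auto simp: ones_vec_def)
qed

lemma det_interp_mat:
  assumes "K \<in> carrier_mat n n"
  shows "det (interp_mat n K p) = (\<Sum>X \<in> Pow {..<n}.
    (\<Prod>i\<in>X. 1 - p i) * (\<Prod>i\<in>{..<n} - X. p i) * det (choose_rows K (1\<^sub>m n - K) X))"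
  unfolding interp_mat_def by (rule det_combine_rows[OF assms])

lemma choose_rows_eq_interp_mat:
  assumes "K \<in> carrier_mat n n"
  shows "choose_rows K (1\<^sub>m n - K) S = interp_mat n K (\<lambda>i. if i \<in> S then 0 else 1)"
  using assms by (intro eq_matI) (auto simp: choose_rows_def interp_mat_def)

lemma interp_mat_mult_vec:
  assumes K: "K \<in> carrier_mat n n" and x: "x \<in> carrier_vec n" and i: "i < n"
  shows "(interp_mat n K p *\<^sub>v x) $ i = p i * (x $ i - (K *\<^sub>v x) $ i) + (1 - p i) * (K *\<^sub>v x) $ i"
proof -
  have "row (interp_mat n K p) i = (1 - p i) \<cdot>\<^sub>v row K i + p i \<cdot>\<^sub>v row (1\<^sub>m n - K) i"
    using K i by (intro eq_vecI) (auto simp: interp_mat_def)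
  moreover have "row (1\<^sub>m n - K) i = unit_vec n i - row K i"
    using K i by (intro eq_vecI) auto
  moreover have "unit_vec n i \<in> carrier_vec n" "row K i \<in> carrier_vec n" using K i by auto
  ultimately show ?thesis
    using K x i by (simp add: interp_mat_def add_scalar_prod_distrib[of _ n]
        minus_scalar_prod_distrib[of _ n] algebra_simps)
qed

lemma det_interp_mat_half:
  assumes K: "K \<in> carrier_mat n n" and p: "\<And>i. i < n \<Longrightarrow> p i = 1/2"
  shows "det (interp_mat n K p) > 0"
proof -
  have "interp_mat n K p = (1/2) \<cdot>\<^sub>m 1\<^sub>m n"
    using K by (intro eq_matI) (auto simp: interp_mat_def p field_simps)
  then show ?thesis by simp
qed

lemma continuous_on_det_interp_mat:
  assumes "K \<in> carrier_mat n n" and "\<And>i. continuous_on T (\<lambda>t. p t i)"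
  shows "continuous_on T (\<lambda>t. det (interp_mat n K (p t)))"
  unfolding det_interp_mat[OF assms(1)] by (intro continuous_intros assms(2))

section \<open>Vertices and interior of the cube\<close>

lemma dpp_kernel_imp_det_interp_mat_pos:
  assumes K: "K \<in> carrier_mat n n" and dpp: "dpp_kernel n K"
    and p: "\<And>i. i < n \<Longrightarrow> 0 < p i \<and> p i < 1"
  shows "det (interp_mat n K p) > 0"
proof -
  let ?w = "\<lambda>X. det (choose_rows K (1\<^sub>m n - K) X)"
  let ?c = "\<lambda>X. (\<Prod>i\<in>X. 1 - p i) * (\<Prod>i\<in>{..<n} - X. p i)"
  have c: "?c X > 0" if "X \<subseteq> {..<n}" for X
    using p that by (intro mult_pos_pos prod_pos) auto
  have w: "?w X \<ge> 0" if "X \<subseteq> {..<n}" for X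
    using that dpp dpp_kernel_iff_det_choose_rows[OF K] by auto
  have "sum ?w (Pow {..<n}) \<noteq> 0" using sum_det_choose_rows[OF K] by simp
  then obtain X where X: "X \<subseteq> {..<n}" "?w X \<noteq> 0"
    by (rule sum.not_neutral_contains_not_neutral) auto
  have "0 < (\<Sum>X \<in> Pow {..<n}. ?c X * ?w X)"
  proof (rule sum_pos2[of _ X])
    show "0 < ?c X * ?w X" using c[OF X(1)] w[OF X(1)] X(2) by simp
    show "0 \<le> ?c Y * ?w Y" if "Y \<in> Pow {..<n}" for Y
      using c[of Y] w[of Y] that by simp
  qed (use X in auto)
  then show ?thesis by (simp add: det_interp_mat[OF K])
qed

text \<open>The point masses are values at vertices of the cube, hence limits of values inside it.\<close>

lemma det_interp_mat_pos_imp_dpp_kernel: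
  assumes K: "K \<in> carrier_mat n n"
    and pos: "\<And>p. (\<And>i. i < n \<Longrightarrow> 0 < p i \<and> p i < 1) \<Longrightarrow> det (interp_mat n K p) > 0"
  shows "dpp_kernel n K"
  unfolding dpp_kernel_iff_det_choose_rows[OF K]
proof (intro allI impI)
  fix S assume "S \<subseteq> {..<n}"
  \<comment> \<open>the segment from the vertex of \<^term>\<open>S\<close> to the centre, which is inside the open cube for $0 < t < 1$\<close>
  define q where "q = (\<lambda>t i. (1 - t) * (if i \<in> S then 0 else 1) + t / 2 :: real)"
  have "continuous_on UNIV (\<lambda>t. det (interp_mat n K (q t)))"
    by (rule continuous_on_det_interp_mat[OF K]) (unfold q_def, intro continuous_intros, simp)
  then have "((\<lambda>t. det (interp_mat n K (q t))) \<longlongrightarrow> det (interp_mat n K (q 0))) (at_right 0)"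
    by (meson UNIV_I continuous_on_def tendsto_within_subset subset_UNIV)
  moreover have "eventually (\<lambda>t. det (interp_mat n K (q t)) \<ge> 0) (at_right 0)"
  proof -
    have "eventually (\<lambda>t. t < (1::real)) (at_right 0)" "eventually (\<lambda>t. 0 < (t::real)) (at_right 0)"
      by (auto simp: eventually_at_right_less intro: eventually_at_rightI[of 0 1])
    then show ?thesis
    proof eventually_elim
      case (elim t)
      then show ?case by (intro less_imp_le pos) (auto simp: q_def)
    qed
  qed
  ultimately have "det (interp_mat n K (q 0)) \<ge> 0"
    by (intro tendsto_lowerbound) auto
  then show "det (choose_rows K (1\<^sub>m n - K) S) \<ge> 0"
    by (simp add: choose_rows_eq_interp_mat[OF K] q_def cong: if_cong)
qed

text \<open>The determinant is positive at the centre of the cube. If it were not positive at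
  \<^term>\<open>p\<close>, it would vanish somewhere on the segment from \<^term>\<open>p\<close> to the centre.\<close>

lemma nonsingular_interp_mat_imp_pos:
  assumes K: "K \<in> carrier_mat n n"
    and nz: "\<And>p. (\<And>i. i < n \<Longrightarrow> 0 < p i \<and> p i < 1) \<Longrightarrow> det (interp_mat n K p) \<noteq> 0"
    and p: "\<And>i. i < n \<Longrightarrow> 0 < p i \<and> p i < 1"
  shows "det (interp_mat n K p) > 0"
proof (rule ccontr)
  assume "\<not> det (interp_mat n K p) > 0"
  define q where "q = (\<lambda>t i. (1 - t) * p i + t / 2 :: real)"
  let ?f = "\<lambda>t. det (interp_mat n K (q t))"
  have "continuous_on {0..1} ?f"
    by (rule continuous_on_det_interp_mat[OF K]) (unfold q_def, intro continuous_intros, simp)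
  moreover have "?f 0 \<le> 0" using \<open>\<not> _\<close> by (simp add: q_def)
  moreover have "0 \<le> ?f 1"
    by (rule less_imp_le, rule det_interp_mat_half[OF K]) (simp add: q_def)
  ultimately obtain t where t: "0 \<le> t" "t \<le> 1" "?f t = 0"
    using IVT'[of ?f 0 0 1] by auto
  have "0 < q t i \<and> q t i < 1" if "i < n" for i
  proof -
    have "q t i = p i + t * (1/2 - p i)" by (simp add: q_def algebra_simps)
    moreover have "0 < q t i"
    proof (cases "t = 0")
      case False
      then show ?thesis using t p[OF that] by (auto simp: q_def intro!: add_nonneg_pos)
    qed (use p[OF that] in \<open>auto simp: q_def\<close>)
    moreover have "0 < (1 - t) * (1 - p i) + t / 2"
    proof (cases "t = 0")
      case False
      then show ?thesis using t p[OF that] by (auto intro!: add_nonneg_pos)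
    qed (use p[OF that] in auto)
    ultimately show ?thesis by (simp add: q_def algebra_simps)
  qed
  then show False using nz t by auto
qed

section \<open>Kernel vectors and sign reversal\<close>

text \<open>Suppose that \<^term>\<open>x\<close> is a kernel vector, and take an index \<^term>\<open>i\<close> as in the
  hypothesis. Multiplied by $x_i$, the equation $p_i(x_i - y_i) + (1 - p_i)y_i = 0$ becomes a sum of
  two nonnegative terms. Both must vanish, so $y_i = x_i$ and $y_i = 0$, against $x_i \<noteq> 0$.\<close>

lemma no_sign_reversal_imp_nonsingular:
  assumes K: "K \<in> carrier_mat n n"
    and c: "\<And>x. x \<in> carrier_vec n \<Longrightarrow> x \<noteq> 0\<^sub>v n \<Longrightarrow>
      \<exists>i<n. x $ i * (K *\<^sub>v x) $ i \<ge> 0 \<and> \<bar>(K *\<^sub>v x) $ i\<bar> \<le> \<bar>x $ i\<bar> \<and> x $ i \<noteq> 0"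
    and p: "\<And>i. i < n \<Longrightarrow> 0 < p i \<and> p i < 1"
  shows "det (interp_mat n K p) \<noteq> 0"
proof
  assume "det (interp_mat n K p) = 0"
  then obtain x where x: "x \<in> carrier_vec n" "x \<noteq> 0\<^sub>v n" "interp_mat n K p *\<^sub>v x = 0\<^sub>v n"
    using det_0_iff_vec_prod_zero[OF interp_mat_carrier] by blast
  obtain i where i: "i < n" and sgn: "x $ i * (K *\<^sub>v x) $ i \<ge> 0"
    and abs: "\<bar>(K *\<^sub>v x) $ i\<bar> \<le> \<bar>x $ i\<bar>" and nz: "x $ i \<noteq> 0"
    using c[OF x(1,2)] by blast
  let ?x = "x $ i" and ?y = "(K *\<^sub>v x) $ i"
  have eq: "p i * (?x - ?y) + (1 - p i) * ?y = 0"
    using interp_mat_mult_vec[OF K x(1) i, of p] x(3) i by simp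
  have "?x * ?y \<le> ?x * ?x"
    using abs abs_le_square_iff[of ?y ?x] mult_mono[of "\<bar>?y\<bar>" "\<bar>?x\<bar>" "\<bar>?x\<bar>" "\<bar>?x\<bar>"]
      abs_mult[of ?x ?y] by (simp add: mult.commute)
  then have le: "0 \<le> ?x * (?x - ?y)" by (simp add: algebra_simps)
  have "p i * (?x * (?x - ?y)) + (1 - p i) * (?x * ?y) = ?x * (p i * (?x - ?y) + (1 - p i) * ?y)"
    by (simp add: algebra_simps)
  also have "\<dots> = 0" using eq by simp
  finally have "p i * (?x * (?x - ?y)) = 0 \<and> (1 - p i) * (?x * ?y) = 0"
    using p[OF i] le sgn by (subst (asm) add_nonneg_eq_0_iff) auto
  then show False using p[OF i] nz by auto
qed

text \<open>Conversely, a vector that violates the condition at every index is a kernel vector for a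
  suitable \<^term>\<open>p\<close> in the open cube.\<close>

lemma sign_reversal_imp_singular:
  assumes K: "K \<in> carrier_mat n n" and x: "x \<in> carrier_vec n" "x \<noteq> 0\<^sub>v n"
    and rev: "\<And>i. i < n \<Longrightarrow> x $ i \<noteq> 0 \<Longrightarrow>
      x $ i * (K *\<^sub>v x) $ i < 0 \<or> \<bar>x $ i\<bar> < \<bar>(K *\<^sub>v x) $ i\<bar>"
  obtains p where "\<And>i. i < n \<Longrightarrow> 0 < p i \<and> p i < 1" "det (interp_mat n K p) = 0"
proof
  let ?y = "K *\<^sub>v x"
  \<comment> \<open>the solution of $p_i(x_i - y_i) + (1 - p_i)y_i = 0$; if $x_i = 0$, then $1/2$ is a solution whatever $y_i$ is\<close>
  define p where "p = (\<lambda>i. if x $ i = 0 then 1/2 else ?y $ i / (2 * ?y $ i - x $ i))"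
  have main: "(0 < p i \<and> p i < 1) \<and> p i * (x $ i - ?y $ i) + (1 - p i) * ?y $ i = 0" if i: "i < n" for i
  proof (cases "x $ i = 0")
    case True
    then show ?thesis by (simp add: p_def)
  next
    case False
    \<comment> \<open>the ratio $y_i / x_i$ lies outside $[0,1]$, so $y_i$ and $y_i - x_i$ have the same sign\<close>
    then consider "0 < ?y $ i" "x $ i < ?y $ i" | "?y $ i < 0" "?y $ i < x $ i"
      using rev[OF i False] by (auto simp: mult_less_0_iff abs_if split: if_splits)
    then have "2 * ?y $ i - x $ i \<noteq> 0 \<and> 0 < p i \<and> p i < 1"
      using False by cases (auto simp: p_def field_simps zero_less_divide_iff divide_less_eq)
    then show ?thesis using False by (auto simp: p_def field_simps)
  qed
  show "0 < p i \<and> p i < 1" if "i < n" for i using main[OF that] by blast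
  have "interp_mat n K p *\<^sub>v x = 0\<^sub>v n"
  proof (rule eq_vecI)
    fix i assume "i < dim_vec (0\<^sub>v n :: real vec)"
    then show "(interp_mat n K p *\<^sub>v x) $ i = 0\<^sub>v n $ i"
      using main[of i] interp_mat_mult_vec[OF K x(1), of i p] by simp
  qed (simp add: interp_mat_def)
  then show "det (interp_mat n K p) = 0"
    using x det_0_iff_vec_prod_zero[OF interp_mat_carrier] by blast
qed

section \<open>Characterisation of DPP kernels\<close>

theorem theorem2p1:
  fixes n :: nat and K :: "real mat"
  assumes "n \<ge> 1" and "K \<in> carrier_mat n n"
  shows
    "(dpp_kernel n K \<longleftrightarrow>
        (\<forall>p \<in> carrier_vec n. (\<forall>i<n. p $ i \<in> {0, 1}) \<longrightarrow>
           det (diag_vec p * (1\<^sub>m n - K) + diag_vec (ones_vec n - p) * K) \<ge> 0)) \<and>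
     (dpp_kernel n K \<longleftrightarrow>
        (\<forall>p \<in> carrier_vec n. (\<forall>i<n. p $ i \<in> {0<..<1}) \<longrightarrow>
           det (diag_vec p * (1\<^sub>m n - K) + diag_vec (ones_vec n - p) * K) > 0)) \<and>
     (dpp_kernel n K \<longleftrightarrow>
        (\<forall>x \<in> carrier_vec n. x \<noteq> 0\<^sub>v n \<longrightarrow>
           (\<exists>i<n. x $ i * (K *\<^sub>v x) $ i \<ge> 0 \<and> \<bar>(K *\<^sub>v x) $ i\<bar> \<le> \<bar>x $ i\<bar> \<and> x $ i \<noteq> 0)))"
    (is "(_ \<longleftrightarrow> ?a) \<and> (_ \<longleftrightarrow> ?b) \<and> (_ \<longleftrightarrow> ?c)")
proof -
  note K = assms(2)
  have interp_mat_cong: "interp_mat n K p = interp_mat n K q" if "\<And>i. i < n \<Longrightarrow> p i = q i" for p q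
    using that by (intro eq_matI) (auto simp: interp_mat_def)
  \<comment> \<open>quantifying over vectors amounts to quantifying over functions on the indices\<close>
  have vec: "(\<forall>p \<in> carrier_vec n. (\<forall>i<n. p $ i \<in> T) \<longrightarrow>
        Q (det (diag_vec p * (1\<^sub>m n - K) + diag_vec (ones_vec n - p) * K))) \<longleftrightarrow>
      (\<forall>p. (\<forall>i<n. p i \<in> T) \<longrightarrow> Q (det (interp_mat n K p)))" for T and Q :: "real \<Rightarrow> bool"
  proof (intro iffI allI ballI impI)
    fix p :: "nat \<Rightarrow> real"
    assume L: "\<forall>p \<in> carrier_vec n. (\<forall>i<n. p $ i \<in> T) \<longrightarrow>
        Q (det (diag_vec p * (1\<^sub>m n - K) + diag_vec (ones_vec n - p) * K))" and p: "\<forall>i<n. p i \<in> T"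
    have "Q (det (interp_mat n K (($) (vec n p))))"
      using L[rule_format, of "vec n p"] p by (simp add: interp_mat_eq[OF K])
    also have "interp_mat n K (($) (vec n p)) = interp_mat n K p" by (rule interp_mat_cong) simp
    finally show "Q (det (interp_mat n K p))" .
  qed (simp add: interp_mat_eq[OF K])
  have "dpp_kernel n K \<longleftrightarrow> ?a"
    unfolding vec[of "{0, 1}" "\<lambda>d. d \<ge> 0"] dpp_kernel_iff_det_choose_rows[OF K]
      choose_rows_eq_interp_mat[OF K]
  proof (intro iffI allI impI)
    fix p :: "nat \<Rightarrow> real"
    assume L: "\<forall>S\<subseteq>{..<n}. 0 \<le> det (interp_mat n K (\<lambda>i. if i \<in> S then 0 else 1))"
      and p: "\<forall>i<n. p i \<in> {0, 1}"
    have "interp_mat n K p = interp_mat n K (\<lambda>i. if i \<in> {i. i < n \<and> p i = 0} then 0 else 1)"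
      using p by (intro interp_mat_cong) auto
    then show "0 \<le> det (interp_mat n K p)"
      using L[rule_format, of "{i. i < n \<and> p i = 0}"] by auto
  qed auto
  moreover have "dpp_kernel n K \<longleftrightarrow> ?b"
    unfolding vec[of "{0<..<1}" "\<lambda>d. d > 0"]
    using dpp_kernel_imp_det_interp_mat_pos[OF K] det_interp_mat_pos_imp_dpp_kernel[OF K] by auto
  moreover have "dpp_kernel n K \<longleftrightarrow> ?c"
  proof
    assume dpp: "dpp_kernel n K"
    show ?c
    proof (rule ccontr)
      assume "\<not> ?c"
      then obtain x where x: "x \<in> carrier_vec n" "x \<noteq> 0\<^sub>v n"
        and "\<And>i. i < n \<Longrightarrow> x $ i \<noteq> 0 \<Longrightarrow> x $ i * (K *\<^sub>v x) $ i < 0 \<or> \<bar>x $ i\<bar> < \<bar>(K *\<^sub>v x) $ i\<bar>"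
        by (meson not_le)
      then obtain p where "\<And>i. i < n \<Longrightarrow> 0 < p i \<and> p i < 1" "det (interp_mat n K p) = 0"
        using sign_reversal_imp_singular[OF K x] by metis
      then show False using dpp_kernel_imp_det_interp_mat_pos[OF K dpp, of p] by simp
    qed
  next
    assume c: ?c
    show "dpp_kernel n K"
      by (intro det_interp_mat_pos_imp_dpp_kernel[OF K] nonsingular_interp_mat_imp_pos[OF K]
          no_sign_reversal_imp_nonsingular[OF K]) (use c in auto)
  qed
  ultimately show ?thesis by blast
qed

end
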